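(* Let $\mathcal R$ be a nonzero $4$-dimensional complex nilpotent pure right alternative algebra. Then $\mathcal R$ is isomorphic to one of the following nine algebras, each given on a basis $e_1,e_2,e_3,e_4$ over $\mathbb C$ (products of basis elements that are not listed are zero): \begin{itemize} \item $\mathcal R^4_1$: $e_1e_1=e_2$, $e_1e_2=e_3$, $e_2e_1=e_3$; \item $\mathcal R^4_2$: $e_1e_1=e_2$, $e_1e_2=e_4$, $e_2e_1=e_4$, $e_3e_3=e_4$; \item $\mathcal R^4_3$: $e_1e_1=e_2$, $e_1e_2=e_4$, $e_2e_1=e_4$, $e_3e_1=e_4$, $e_3e_3=e_4$; \item $\mathcal R^4_4$: $e_1e_1=e_2$, $e_1e_2=e_4$, $e_2e_1=e_4$, $e_3e_1=e_4$; \item $\mathcal R^4_5$: $e_1e_2=e_3$, $e_1e_3=e_4$, $e_2e_1=-e_3$; \item $\mathcal R^4_6$: $e_1e_2=e_3$, $e_1e_3=e_4$, $e_2e_1=-e_3$, $e_2e_2=e_4$; \item $\mathcal R^4_7$: $e_2e_1=e_3$, $e_2e_2=e_3$, $e_2e_3=e_4$, $e_3e_2=e_4$; \item $\mathcal R^4_8$: $e_1e_1=e_4$, $e_2e_1=e_3$, $e_2e_2=e_3$, $e_2e_3=e_4$, $e_3e_2=e_4$; \item $\mathcal R^4_9$: $e_1e_1=e_2$, $e_1e_2=e_3$, $e_1e_3=e_4$, $e_2e_1=e_3$, $e_2e_2=e_4$, $e_3e_1=e_4$. \end{itemize}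
   Context: An algebra over $\mathbb C$ is a complex vector space with a bilinear product, not assumed associative or unital. It is right alternative if it satisfies the identity $(xy)z-x(yz)=-(xz)y+x(zy)$ for all $x,y,z$. It is nilpotent if there is an integer $k\ge 1$ such that every product of $k$ elements, with any arrangement of parentheses, is zero. A nilpotent right alternative algebra is called non-pure if it satisfies both identities $(xy)z=0$ and $x(yz)=0$, and it is called pure otherwise. *)

theory Defs
  imports "HOL-Analysis.Analysis"
begin

locale complex_algebra = vector_space smul
  for smul :: "complex \<Rightarrow> 'a::ab_group_add \<Rightarrow> 'a" +
  fixes mul :: "'a \<Rightarrow> 'a \<Rightarrow> 'a"
  assumes linear_mul_right: "Vector_Spaces.linear smul smul (\<lambda>y. mul x y)"
    and linear_mul_left: "Vector_Spaces.linear smul smul (\<lambda>x. mul x y)"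

definition right_alternative :: "('a::ab_group_add \<Rightarrow> 'a \<Rightarrow> 'a) \<Rightarrow> bool" where
  "right_alternative mul \<longleftrightarrow>
     (\<forall>x y z. mul (mul x y) z - mul x (mul y z) = - mul (mul x z) y + mul x (mul z y))"

(* is_product mul k p: p is the value of some bracketing of a product of k elements. *)
inductive is_product :: "('a \<Rightarrow> 'a \<Rightarrow> 'a) \<Rightarrow> nat \<Rightarrow> 'a \<Rightarrow> bool"
  for mul :: "'a \<Rightarrow> 'a \<Rightarrow> 'a" where
  single: "is_product mul 1 x"
| times: "is_product mul m x \<Longrightarrow> is_product mul n y \<Longrightarrow> is_product mul (m + n) (mul x y)"

definition nilpotent_algebra :: "('a::ab_group_add \<Rightarrow> 'a \<Rightarrow> 'a) \<Rightarrow> bool" where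
  "nilpotent_algebra mul \<longleftrightarrow> (\<exists>k\<ge>1. \<forall>p. is_product mul k p \<longrightarrow> p = 0)"

definition non_pure_algebra :: "('a::ab_group_add \<Rightarrow> 'a \<Rightarrow> 'a) \<Rightarrow> bool" where
  "non_pure_algebra mul \<longleftrightarrow>
     (\<forall>x y z. mul (mul x y) z = 0) \<and> (\<forall>x y z. mul x (mul y z) = 0)"

definition pure_algebra :: "('a::ab_group_add \<Rightarrow> 'a \<Rightarrow> 'a) \<Rightarrow> bool" where
  "pure_algebra mul \<longleftrightarrow> \<not> non_pure_algebra mul"

definition algebra_isomorphic ::
  "(complex \<Rightarrow> 'a::ab_group_add \<Rightarrow> 'a) \<Rightarrow> ('a \<Rightarrow> 'a \<Rightarrow> 'a) \<Rightarrow>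
   (complex \<Rightarrow> 'b::ab_group_add \<Rightarrow> 'b) \<Rightarrow> ('b \<Rightarrow> 'b \<Rightarrow> 'b) \<Rightarrow> bool" where
  "algebra_isomorphic smul mul smul' mul' \<longleftrightarrow>
     (\<exists>f. Vector_Spaces.linear smul smul' f \<and> bij f \<and>
          (\<forall>x y. f (mul x y) = mul' (f x) (f y)))"

(* In the index type 4 the numeral 4 equals 0, so 1, 2, 3, 4 are its four distinct elements. *)
definition ee :: "4 \<Rightarrow> complex ^ 4" where
  "ee i = axis i 1"

(* The bilinear product on complex ^ 4 in which ee i times ee j is v for every entry
   ((i, j), v) of the list and 0 for the pairs (i, j) that do not occur in it. *)
definition table_mul ::
  "((4 \<times> 4) \<times> (complex ^ 4)) list \<Rightarrow> complex ^ 4 \<Rightarrow> complex ^ 4 \<Rightarrow> complex ^ 4" where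
  "table_mul t x y =
     (\<Sum>i\<in>UNIV. \<Sum>j\<in>UNIV.
        (x $ i * y $ j) *s (case map_of t (i, j) of None \<Rightarrow> 0 | Some v \<Rightarrow> v))"

definition R4_1 :: "complex ^ 4 \<Rightarrow> complex ^ 4 \<Rightarrow> complex ^ 4" where
  "R4_1 = table_mul [((1, 1), ee 2), ((1, 2), ee 3), ((2, 1), ee 3)]"

definition R4_2 :: "complex ^ 4 \<Rightarrow> complex ^ 4 \<Rightarrow> complex ^ 4" where
  "R4_2 = table_mul [((1, 1), ee 2), ((1, 2), ee 4), ((2, 1), ee 4), ((3, 3), ee 4)]"

definition R4_3 :: "complex ^ 4 \<Rightarrow> complex ^ 4 \<Rightarrow> complex ^ 4" where
  "R4_3 = table_mul
     [((1, 1), ee 2), ((1, 2), ee 4), ((2, 1), ee 4), ((3, 1), ee 4), ((3, 3), ee 4)]"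

definition R4_4 :: "complex ^ 4 \<Rightarrow> complex ^ 4 \<Rightarrow> complex ^ 4" where
  "R4_4 = table_mul [((1, 1), ee 2), ((1, 2), ee 4), ((2, 1), ee 4), ((3, 1), ee 4)]"

definition R4_5 :: "complex ^ 4 \<Rightarrow> complex ^ 4 \<Rightarrow> complex ^ 4" where
  "R4_5 = table_mul [((1, 2), ee 3), ((1, 3), ee 4), ((2, 1), - ee 3)]"

definition R4_6 :: "complex ^ 4 \<Rightarrow> complex ^ 4 \<Rightarrow> complex ^ 4" where
  "R4_6 = table_mul [((1, 2), ee 3), ((1, 3), ee 4), ((2, 1), - ee 3), ((2, 2), ee 4)]"

definition R4_7 :: "complex ^ 4 \<Rightarrow> complex ^ 4 \<Rightarrow> complex ^ 4" where
  "R4_7 = table_mul [((2, 1), ee 3), ((2, 2), ee 3), ((2, 3), ee 4), ((3, 2), ee 4)]"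

definition R4_8 :: "complex ^ 4 \<Rightarrow> complex ^ 4 \<Rightarrow> complex ^ 4" where
  "R4_8 = table_mul
     [((1, 1), ee 4), ((2, 1), ee 3), ((2, 2), ee 3), ((2, 3), ee 4), ((3, 2), ee 4)]"

definition R4_9 :: "complex ^ 4 \<Rightarrow> complex ^ 4 \<Rightarrow> complex ^ 4" where
  "R4_9 = table_mul
     [((1, 1), ee 2), ((1, 2), ee 3), ((1, 3), ee 4), ((2, 1), ee 3), ((2, 2), ee 4), ((3, 1), ee 4)]"

end

theory Submission imports Defs begin

text \<open>Let $A^1 = A$ and let $A^{n+1}$ be spanned by $A^n A$ and $A A^n$. By nilpotency this series
  decreases strictly until it is zero, so $A^5 = 0$, and purity means $A^3 \<noteq> 0$. Hence $A^2$ has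
  dimension 3 or 2. In the first case $A$ is generated by one element, and right
  alternativity forces the multiplication of the powers of the generator to be that of $R^4_9$.
  In the second case $A^3$ is a line annihilated by $A$, and $A^2 A^2 = 0$. Modulo $A^3$ the product is
  then a bilinear form $\<phi>$ on the plane $A / A^2$, and the actions of $A$ on $A^2 / A^3$ from both sides are
  linear forms $\<alpha>$, $\<beta>$ with $\<phi>(x,y) \<alpha>(y) = \<beta>(x) \<phi>(y,y)$. It follows that $\<beta> \<noteq> 0$, and that
  either $\<alpha> = 0$ and $\<phi>$ is alternating, or $\<alpha> = \<beta>$ and $\<phi> = \<beta> \<otimes> \<gamma>$, where
  $\<gamma>$ is or is not proportional to $\<beta>$. In each of these three cases an explicit change of basis
  reaches one of the normal forms.\<close>

section \<open>Coordinates\<close>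

lemma vec4_eq_iff: "x = y \<longleftrightarrow> x$1 = y$1 \<and> x$2 = y$2 \<and> x$3 = y$3 \<and> x$4 = y$4" for x y :: "'b ^ 4"
  by (simp add: vec_eq_iff forall_4)

lemmas table_simps = table_mul_def sum_4 ee_def axis_def

lemma R4_1_nth:
  "R4_1 x y $ 1 = 0" "R4_1 x y $ 2 = x$1 * y$1"
  "R4_1 x y $ 3 = x$1 * y$2 + x$2 * y$1" "R4_1 x y $ 4 = 0"
  by (simp_all add: R4_1_def table_simps)

lemma R4_2_nth:
  "R4_2 x y $ 1 = 0" "R4_2 x y $ 2 = x$1 * y$1"
  "R4_2 x y $ 3 = 0" "R4_2 x y $ 4 = x$1 * y$2 + x$2 * y$1 + x$3 * y$3"
  by (simp_all add: R4_2_def table_simps)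

lemma R4_3_nth:
  "R4_3 x y $ 1 = 0" "R4_3 x y $ 2 = x$1 * y$1"
  "R4_3 x y $ 3 = 0" "R4_3 x y $ 4 = x$1 * y$2 + x$2 * y$1 + x$3 * y$1 + x$3 * y$3"
  by (simp_all add: R4_3_def table_simps)

lemma R4_4_nth:
  "R4_4 x y $ 1 = 0" "R4_4 x y $ 2 = x$1 * y$1"
  "R4_4 x y $ 3 = 0" "R4_4 x y $ 4 = x$1 * y$2 + x$2 * y$1 + x$3 * y$1"
  by (simp_all add: R4_4_def table_simps)

lemma R4_5_nth:
  "R4_5 x y $ 1 = 0" "R4_5 x y $ 2 = 0"
  "R4_5 x y $ 3 = x$1 * y$2 - x$2 * y$1" "R4_5 x y $ 4 = x$1 * y$3"
  by (simp_all add: R4_5_def table_simps)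

lemma R4_6_nth:
  "R4_6 x y $ 1 = 0" "R4_6 x y $ 2 = 0"
  "R4_6 x y $ 3 = x$1 * y$2 - x$2 * y$1" "R4_6 x y $ 4 = x$1 * y$3 + x$2 * y$2"
  by (simp_all add: R4_6_def table_simps)

lemma R4_7_nth:
  "R4_7 x y $ 1 = 0" "R4_7 x y $ 2 = 0"
  "R4_7 x y $ 3 = x$2 * y$1 + x$2 * y$2" "R4_7 x y $ 4 = x$2 * y$3 + x$3 * y$2"
  by (simp_all add: R4_7_def table_simps)

lemma R4_8_nth:
  "R4_8 x y $ 1 = 0" "R4_8 x y $ 2 = 0"
  "R4_8 x y $ 3 = x$2 * y$1 + x$2 * y$2" "R4_8 x y $ 4 = x$1 * y$1 + x$2 * y$3 + x$3 * y$2"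
  by (simp_all add: R4_8_def table_simps)

lemma R4_9_nth:
  "R4_9 x y $ 1 = 0" "R4_9 x y $ 2 = x$1 * y$1"
  "R4_9 x y $ 3 = x$1 * y$2 + x$2 * y$1" "R4_9 x y $ 4 = x$1 * y$3 + x$2 * y$2 + x$3 * y$1"
  by (simp_all add: R4_9_def table_simps)

lemmas R4_nth = R4_1_nth R4_2_nth R4_3_nth R4_4_nth R4_5_nth R4_6_nth R4_7_nth R4_8_nth R4_9_nth

definition vec4 :: "'b \<Rightarrow> 'b \<Rightarrow> 'b \<Rightarrow> 'b \<Rightarrow> 'b ^ 4" where
  "vec4 a b c d = (\<chi> i. if i = 1 then a else if i = 2 then b else if i = 3 then c else d)"

lemma vec4_nth [simp]:
  "vec4 a b c d $ 1 = a" "vec4 a b c d $ 2 = b" "vec4 a b c d $ 3 = c" "vec4 a b c d $ 4 = d"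
  by (simp_all add: vec4_def)

section \<open>Isomorphisms as changes of basis\<close>

lemma linearI:
  assumes "vector_space s1" "vector_space s2"
    and "\<And>x y. f (x + y) = f x + f y" "\<And>c x. f (s1 c x) = s2 c (f x)"
  shows "Vector_Spaces.linear s1 s2 f"
  using assms
  by (simp add: Vector_Spaces.linear_def module_hom_def module_hom_axioms_def
      module_iff_vector_space)

text \<open>The map starts at the target algebra because a change of basis is most easily given by
  sending coordinates to the vector they describe; its inverse is the isomorphism.\<close>

lemma algebra_isomorphicI:
  assumes "Vector_Spaces.linear s' s g" "bij g" "\<And>x y. g (m' x y) = m (g x) (g y)"
  shows "algebra_isomorphic s m s' m'"
  unfolding algebra_isomorphic_def
proof (intro exI conjI allI)
  interpret g: Vector_Spaces.linear s' s g by fact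
  have [simp]: "inv g (g x) = x" "g (inv g y) = y" for x y
    using assms(2) by (simp_all add: bij_is_inj bij_is_surj surj_f_inv_f)
  have "inv g (x + y) = inv g x + inv g y" "inv g (s c x) = s' c (inv g x)" for x y c
    by (rule inv_f_eq[OF bij_is_inj[OF assms(2)]], simp add: g.add g.scale)+
  then show "Vector_Spaces.linear s s' (inv g)"
    by (intro linearI g.vs1.vector_space_axioms g.vs2.vector_space_axioms)
  show "bij (inv g)" using assms(2) by (rule bij_imp_bij_inv)
  show "inv g (m x y) = m' (inv g x) (inv g y)" for x y
    by (rule inv_f_eq) (use assms in \<open>simp_all add: bij_is_inj\<close>)
qed

lemma algebra_isomorphic_trans:
  assumes "algebra_isomorphic s m s' m'" "algebra_isomorphic s' m' s'' m''"
  shows "algebra_isomorphic s m s'' m''"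
proof -
  obtain f g where f: "Vector_Spaces.linear s s' f" "bij f" "\<And>x y. f (m x y) = m' (f x) (f y)"
    and g: "Vector_Spaces.linear s' s'' g" "bij g" "\<And>x y. g (m' x y) = m'' (g x) (g y)"
    using assms unfolding algebra_isomorphic_def by auto
  show ?thesis
    unfolding algebra_isomorphic_def
    by (intro exI[of _ "g \<circ> f"] conjI allI Vector_Spaces.linear_compose[OF f(1) g(1)] bij_comp f g)
      (simp add: f g)
qed

text \<open>An injective endomorphism of a finite-dimensional space is bijective. In the
  applications \<open>h\<close> sends each basis vector of the normal form \<open>m'\<close> to the
  vector that realises it in \<open>m\<close>.\<close>

lemma algebra_isomorphic_vec4I:
  fixes h :: "complex ^ 4 \<Rightarrow> complex ^ 4"
  assumes "\<And>x y. h (x + y) = h x + h y" "\<And>c x. h (c *s x) = c *s h x"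
    and "\<And>x. h x = 0 \<Longrightarrow> x = 0"
    and "\<And>x y. h (m' x y) = m (h x) (h y)"
  shows "algebra_isomorphic (*s) m (*s) m'"
proof (rule algebra_isomorphicI)
  show h: "Vector_Spaces.linear (*s) (*s) h"
    using assms(1,2) by (intro linearI vec.vector_space_axioms)
  have "inj h"
  proof (rule injI)
    fix x y assume "h x = h y"
    then have "h (x - y) = 0" using assms(1)[of "x - y" y] by simp
    then show "x = y" using assms(3)[of "x - y"] by simp
  qed
  then show "bij h" using vec.linear_injective_imp_surjective[OF h] by (simp add: bij_def)
qed fact

section \<open>Normal forms when the square has dimension two\<close>

text \<open>With respect to a basis $a, b, c, d$ such that $A^2$ is spanned by $c, d$ and $A^3$ by $d$, the
  matrices \<open>P\<close> and \<open>Q\<close> hold the coefficients of $c$ and $d$ in the products of $a$ and $b$, and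
  \<open>\<alpha>\<close> those of $d$ in $c a$ and $c b$. The form $\<beta>$ is normalised by $a c = d$, $b c = 0$.\<close>

definition graded_mul ::
  "complex ^ 2 ^ 2 \<Rightarrow> complex ^ 2 ^ 2 \<Rightarrow> complex ^ 2 \<Rightarrow> complex ^ 4 \<Rightarrow> complex ^ 4 \<Rightarrow> complex ^ 4" where
  "graded_mul P Q \<alpha> x y = vec4 0 0
     (P$1$1 * x$1 * y$1 + P$1$2 * x$1 * y$2 + P$2$1 * x$2 * y$1 + P$2$2 * x$2 * y$2)
     (Q$1$1 * x$1 * y$1 + Q$1$2 * x$1 * y$2 + Q$2$1 * x$2 * y$1 + Q$2$2 * x$2 * y$2
      + x$1 * y$3 + x$3 * (\<alpha>$1 * y$1 + \<alpha>$2 * y$2))"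

lemma graded_mul_alternating:
  assumes P: "P$1$1 = 0" "P$2$2 = 0" "P$2$1 = - P$1$2" "P$1$2 \<noteq> 0" and \<alpha>: "\<alpha>$1 = 0" "\<alpha>$2 = 0"
  shows "\<exists>R\<in>{R4_5, R4_6}. algebra_isomorphic (*s) (graded_mul P Q \<alpha>) (*s) R"
proof -
  define p where "p = P$1$2"
  \<comment> \<open>The new basis is e1 = a + s c, e2 = r (b + t c), e3 = e1 e2, e4 = e1 e3. Here
    \<open>s\<close> makes e1 e1 = 0, \<open>t\<close> makes e2 e1 = - e1 e2, and \<open>r\<close>
    scales e2 e2 to e4 unless it is zero.\<close>
  define r where "r = (if Q$2$2 = 0 then 1 else p / Q$2$2)"
  define s where "s = - Q$1$1"
  define t where "t = - Q$1$2 - Q$2$1"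
  define h :: "complex ^ 4 \<Rightarrow> complex ^ 4"
    where "h x = vec4 (x$1) (r * x$2) (s * x$1 + r * t * x$2 + r * p * x$3)
      (- r * Q$2$1 * x$3 + r * p * x$4)" for x
  have p: "p \<noteq> 0" and r: "r \<noteq> 0" using P by (auto simp: p_def r_def)
  have "algebra_isomorphic (*s) (graded_mul P Q \<alpha>) (*s) (if Q$2$2 = 0 then R4_5 else R4_6)"
  proof (rule algebra_isomorphic_vec4I)
    show "h x = 0 \<Longrightarrow> x = 0" for x
      using p r by (auto simp: h_def vec4_eq_iff)
    show "h ((if Q$2$2 = 0 then R4_5 else R4_6) x y) = graded_mul P Q \<alpha> (h x) (h y)" for x y
      using P \<alpha> p by (auto simp: h_def vec4_eq_iff graded_mul_def R4_nth r_def s_def t_def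
          p_def[symmetric] field_simps)
  qed (simp_all add: h_def vec4_eq_iff algebra_simps)
  then show ?thesis by (auto split: if_splits)
qed

lemma graded_mul_rank_one_dependent:
  assumes P: "P$1$2 = 0" "P$2$1 = 0" "P$2$2 = 0" "P$1$1 \<noteq> 0" and \<alpha>: "\<alpha>$1 = 1" "\<alpha>$2 = 0"
  shows "\<exists>R\<in>{R4_1, R4_2, R4_3, R4_4}. algebra_isomorphic (*s) (graded_mul P Q \<alpha>) (*s) R"
proof -
  define p where "p = P$1$1"
  \<comment> \<open>Replacing b by b + t c gives a b = 0; then \<tau> and \<sigma> are the
    d-coefficients of b a and b b, and their vanishing decides the normal form.\<close>
  define t where "t = - Q$1$2"
  define \<tau> where "\<tau> = Q$2$1 - Q$1$2"
  define \<sigma> where "\<sigma> = Q$2$2"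
  note defs = p_def[symmetric] t_def vec4_eq_iff graded_mul_def R4_nth
  have Q: "Q$2$1 = \<tau> + Q$1$2" "Q$2$2 = \<sigma>" by (simp_all add: \<tau>_def \<sigma>_def)
  have p: "p \<noteq> 0" using P by (auto simp: p_def)
  \<comment> \<open>Up to parameters \<open>u\<close>, \<open>v\<close>, the algebras R4_2, R4_3,
    R4_4 share one shape. The new basis is e1 = l a, e2 = e1 e1, e3 = m (b + t c), e4 = e1 e2, and
    \<open>uv\<close> expresses e3 e1 = u e4 and e3 e3 = v e4.\<close>
  have iso: "algebra_isomorphic (*s) (graded_mul P Q \<alpha>) (*s) R"
    if R: "\<And>x y. R x y = vec4 0 (x$1 * y$1) 0 (x$1 * y$2 + x$2 * y$1 + u * x$3 * y$1 + v * x$3 * y$3)"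
      and nz: "l \<noteq> 0" "m \<noteq> 0"
      and uv: "m * \<tau> = u * l^2 * p" "m^2 * \<sigma> = v * l^3 * p" for R u v l m
  proof -
    define h :: "complex ^ 4 \<Rightarrow> complex ^ 4"
    where "h x = vec4 (l * x$1) (m * x$3) (l^2 * p * x$2 + m * t * x$3)
        (l^2 * Q$1$1 * x$2 + l^3 * p * x$4)" for x
    have Q': "Q$2$1 = u * l^2 * p / m + Q$1$2" "Q$2$2 = v * l^3 * p / m^2"
      using nz Q uv by (simp_all add: eq_divide_eq mult.commute)
    show ?thesis
    proof (rule algebra_isomorphic_vec4I)
      show "h x = 0 \<Longrightarrow> x = 0" for x
        using p nz by (auto simp add: h_def vec4_eq_iff)
      show "h (R x y) = graded_mul P Q \<alpha> (h x) (h y)" for x y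
        using P \<alpha> nz by (simp add: h_def R defs Q' field_simps power2_eq_square power3_eq_cube)
    qed (simp_all add: h_def vec4_eq_iff algebra_simps)
  qed
  consider "\<tau> = 0" "\<sigma> = 0" | "\<tau> = 0" "\<sigma> \<noteq> 0" | "\<tau> \<noteq> 0" "\<sigma> = 0" | "\<tau> \<noteq> 0" "\<sigma> \<noteq> 0" by blast
  then show ?thesis
  proof cases
    case 1
    \<comment> \<open>In R4_1 it is e3 that spans A^3, while e4, realised by b + t c, annihilates
      the algebra.\<close>
    define h :: "complex ^ 4 \<Rightarrow> complex ^ 4"
    where "h x = vec4 (x$1) (x$4) (p * x$2 + t * x$4) (Q$1$1 * x$2 + p * x$3)" for x
    have "algebra_isomorphic (*s) (graded_mul P Q \<alpha>) (*s) R4_1"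
    proof (rule algebra_isomorphic_vec4I)
      show "h x = 0 \<Longrightarrow> x = 0" for x
        using p by (auto simp add: h_def vec4_eq_iff)
      show "h (R4_1 x y) = graded_mul P Q \<alpha> (h x) (h y)" for x y
        using P \<alpha> by (simp add: h_def defs Q 1 algebra_simps)
    qed (simp_all add: h_def vec4_eq_iff algebra_simps)
    then show ?thesis by blast
  next
    case 2
    have "algebra_isomorphic (*s) (graded_mul P Q \<alpha>) (*s) R4_2"
      by (rule iso[of _ 0 1 1 "csqrt (p / \<sigma>)"])
        (use p 2 in \<open>simp_all add: vec4_eq_iff R4_nth\<close>)
    then show ?thesis by blast
  next
    case 3
    have "algebra_isomorphic (*s) (graded_mul P Q \<alpha>) (*s) R4_4"
      by (rule iso[of _ 1 0 1 "p / \<tau>"]) (use p 3 in \<open>simp_all add: vec4_eq_iff R4_nth\<close>)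
    then show ?thesis by blast
  next
    case 4
    \<comment> \<open>For u = v = 1 the first condition gives m = l^2 p / \<tau>; substituted in m^2
      \<sigma> = l^3 p, this leaves the present value of l.\<close>
    define l where "l = \<tau>^2 / (p * \<sigma>)"
    have l: "l \<noteq> 0" using 4 p by (simp add: l_def)
    have "(l^2 * p / \<tau>)^2 * \<sigma> = 1 * l^3 * p"
      using p 4 by (simp add: l_def field_simps power2_eq_square power3_eq_cube)
    then have "algebra_isomorphic (*s) (graded_mul P Q \<alpha>) (*s) R4_3"
      by (intro iso[of _ 1 1 l "l^2 * p / \<tau>"]) (use p 4 l in \<open>simp_all add: vec4_eq_iff R4_nth\<close>)
    then show ?thesis by blast
  qed
qed

lemma graded_mul_rank_one_independent:
  assumes P: "P$1$2 \<noteq> 0" "P$2$1 = 0" "P$2$2 = 0" and \<alpha>: "\<alpha>$1 = 1" "\<alpha>$2 = 0"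
  shows "\<exists>R\<in>{R4_7, R4_8}. algebra_isomorphic (*s) (graded_mul P Q \<alpha>) (*s) R"
proof -
  \<comment> \<open>\<open>k\<close> makes $\<phi>(e_2, e_1) = \<phi>(e_2, e_2)$, \<open>t\<close> makes $e_1 e_2 = 0$, \<open>s\<close> makes $e_2 e_1 = e_2 e_2$,
    and \<open>l\<close> scales $e_1 e_1$ to $e_4$ unless it is zero.\<close>
  define p where "p = P$1$2"
  define k where "k = (p - P$1$1) / p"
  define l where "l = (if Q$2$2 = 0 then 1 else Q$2$2 / p)"
  define t where "t = - Q$2$1 - k * Q$2$2"
  define s where "s = (Q$1$2 + k * Q$2$2 + t - (Q$1$1 + k * Q$1$2 + k * Q$2$1 + k^2 * Q$2$2)) / 2"
  \<comment> \<open>The roles are exchanged: e2 = l (a + k b + s c) replaces a and e1 = l (b + t c)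
    replaces b, with e3 = e2 e1 and e4 = e2 e3.\<close>
  define h :: "complex ^ 4 \<Rightarrow> complex ^ 4"
    where "h x = vec4 (l * x$2) (l * x$1 + l * k * x$2)
     (l * t * x$1 + l * s * x$2 + l^2 * p * x$3)
     (l^2 * (Q$1$2 + k * Q$2$2 + t) * x$3 + l^3 * p * x$4)" for x
  have p: "p \<noteq> 0" and l: "l \<noteq> 0" using P by (auto simp: p_def l_def)
  have P11: "P$1$1 = p - k * p" using p by (simp add: k_def)
  have Q': "Q$2$1 = - t - k * Q$2$2"
    "Q$1$1 = Q$1$2 + k * Q$2$2 + t - 2 * s - k * Q$1$2 + k * t"
    by (simp_all add: s_def t_def field_simps power2_eq_square)
  have "algebra_isomorphic (*s) (graded_mul P Q \<alpha>) (*s) (if Q$2$2 = 0 then R4_7 else R4_8)"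
    (is "algebra_isomorphic _ _ _ ?R")
  proof (rule algebra_isomorphic_vec4I)
    show "h x = 0 \<Longrightarrow> x = 0" for x
      using p l by (auto simp add: h_def vec4_eq_iff)
    show "h (?R x y) = graded_mul P Q \<alpha> (h x) (h y)" for x y
    proof (cases "Q$2$2 = 0")
      case True
      then have "l = 1" by (simp add: l_def)
      with True show ?thesis
        using P \<alpha> by (simp add: h_def vec4_eq_iff graded_mul_def R4_nth P11 Q'
            p_def[symmetric] algebra_simps power2_eq_square)
    next
      case False
      then have "Q$2$2 = l * p" using p by (simp add: l_def)
      with l p show ?thesis
        using P \<alpha> by (simp add: h_def vec4_eq_iff graded_mul_def R4_nth P11 Q'
            p_def[symmetric] algebra_simps power2_eq_square power3_eq_cube)
    qed
  qed (simp_all add: h_def vec4_eq_iff algebra_simps)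
  then show ?thesis by (auto split: if_splits)
qed

text \<open>Comparing d-coefficients in (x y) y = x (y y) gives \<phi>(x,y) \<alpha>(y) = \<beta>(x)
  \<phi>(y,y), where \<beta>(a) = 1 and \<beta>(b) = 0. The six equations are the coefficients of
  y1^2, y1 y2, y2^2 for x = a and x = b.\<close>

lemma right_alternative_graded_mulD:
  assumes "right_alternative (graded_mul P Q \<alpha>)"
  shows "P$1$1 * \<alpha>$1 = P$1$1" "P$1$1 * \<alpha>$2 + P$1$2 * \<alpha>$1 = P$1$2 + P$2$1" "P$1$2 * \<alpha>$2 = P$2$2"
    and "P$2$1 * \<alpha>$1 = 0" "P$2$1 * \<alpha>$2 + P$2$2 * \<alpha>$1 = 0" "P$2$2 * \<alpha>$2 = 0"
proof -
  let ?m = "graded_mul P Q \<alpha>"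
  have *: "(?m (?m x y) z - ?m x (?m y z)) $ 4 = (- ?m (?m x z) y + ?m x (?m z y)) $ 4" for x y z
    using assms unfolding right_alternative_def by metis
  show "P$1$1 * \<alpha>$1 = P$1$1"
    using *[of "vec4 1 0 0 0" "vec4 1 0 0 0" "vec4 1 0 0 0"] by (simp add: graded_mul_def)
  show "P$1$1 * \<alpha>$2 + P$1$2 * \<alpha>$1 = P$1$2 + P$2$1"
    using *[of "vec4 1 0 0 0" "vec4 1 0 0 0" "vec4 0 1 0 0"] by (simp add: graded_mul_def algebra_simps)
  show "P$1$2 * \<alpha>$2 = P$2$2"
    using *[of "vec4 1 0 0 0" "vec4 0 1 0 0" "vec4 0 1 0 0"] by (simp add: graded_mul_def mult.commute)
  show "P$2$1 * \<alpha>$1 = 0"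
    using *[of "vec4 0 1 0 0" "vec4 1 0 0 0" "vec4 1 0 0 0"] by (auto simp: graded_mul_def)
  show "P$2$1 * \<alpha>$2 + P$2$2 * \<alpha>$1 = 0"
    using *[of "vec4 0 1 0 0" "vec4 1 0 0 0" "vec4 0 1 0 0"]
    by (simp add: graded_mul_def algebra_simps eq_neg_iff_add_eq_0)
  show "P$2$2 * \<alpha>$2 = 0"
    using *[of "vec4 0 1 0 0" "vec4 0 1 0 0" "vec4 0 1 0 0"] by (auto simp: graded_mul_def)
qed

lemma graded_mul_classification:
  assumes ra: "right_alternative (graded_mul P Q \<alpha>)" and "P \<noteq> 0"
  shows "\<exists>R \<in> {R4_1, R4_2, R4_3, R4_4, R4_5, R4_6, R4_7, R4_8, R4_9}.
           algebra_isomorphic (*s) (graded_mul P Q \<alpha>) (*s) R"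
proof -
  note eqs = right_alternative_graded_mulD[OF ra]
  have nz: "P$1$1 \<noteq> 0 \<or> P$1$2 \<noteq> 0 \<or> P$2$1 \<noteq> 0 \<or> P$2$2 \<noteq> 0"
    using \<open>P \<noteq> 0\<close> by (auto simp: vec_eq_iff forall_2)
  \<comment> \<open>A nonzero \<open>P$2$2\<close> would force \<open>\<alpha>$2 = 0\<close>, and
    then \<open>P$2$2 = P$1$2 * \<alpha>$2\<close> would vanish.\<close>
  have P22: "P$2$2 = 0" using eqs by auto
  show ?thesis
  proof (cases "P$2$1 = 0")
    case False
    then have "\<alpha>$1 = 0" "\<alpha>$2 = 0" using eqs P22 by auto
    moreover from this have "P$1$1 = 0" "P$2$1 = - P$1$2"
      using eqs by (auto simp: eq_neg_iff_add_eq_0 add.commute)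
    ultimately show ?thesis
      using graded_mul_alternating[of P \<alpha> Q] P22 False by auto
  next
    case True
    \<comment> \<open>Only the first row of \<open>P\<close> is left; cancelling a nonzero entry of
      it in the equations forces \<alpha> = \<beta>.\<close>
    have "\<alpha>$1 = 1 \<and> \<alpha>$2 = 0"
      using eqs nz True P22 by (cases "P$1$1 = 0") auto
    then show ?thesis
      using graded_mul_rank_one_dependent[of P \<alpha> Q] graded_mul_rank_one_independent[of P \<alpha> Q]
        nz True P22 by (cases "P$1$2 = 0") auto
  qed
qed

section \<open>The lower series\<close>

context complex_algebra
begin

lemma mul_linear_simps:
  "mul (x + y) z = mul x z + mul y z" "mul z (x + y) = mul z x + mul z y"
  "mul (x - y) z = mul x z - mul y z" "mul z (x - y) = mul z x - mul z y"
  "mul (smul c x) z = smul c (mul x z)" "mul z (smul c x) = smul c (mul z x)"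
  "mul 0 z = 0" "mul z 0 = 0"
proof -
  interpret r: Vector_Spaces.linear smul smul "\<lambda>y. mul z y" by (rule linear_mul_right)
  interpret l: Vector_Spaces.linear smul smul "\<lambda>x. mul x z" by (rule linear_mul_left)
  show "mul (x + y) z = mul x z + mul y z" "mul z (x + y) = mul z x + mul z y"
  "mul (x - y) z = mul x z - mul y z" "mul z (x - y) = mul z x - mul z y"
  "mul (smul c x) z = smul c (mul x z)" "mul z (smul c x) = smul c (mul z x)"
  "mul 0 z = 0" "mul z 0 = 0"
    by (simp_all add: r.add l.add r.diff l.diff r.scale l.scale)
qed

text \<open>Unlike the powers spanned by all bracketings of a fixed length, which may stabilise temporarily
  at a nonzero value, this series is strictly decreasing until it reaches zero, because each term
  determines the next. Indexing: the term \<open>lower n\<close> is $A^{n+1}$, so that \<open>lower 0\<close> is the algebra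
  itself.\<close>

primrec lower :: "nat \<Rightarrow> 'a set" where
  "lower 0 = UNIV"
| "lower (Suc n) = span {mul x y |x y. x \<in> lower n \<or> y \<in> lower n}"

lemma subspace_lower: "subspace (lower n)"
  by (cases n) auto

lemmas lower_closed = subspace_add[OF subspace_lower] subspace_diff[OF subspace_lower]
  subspace_scale[OF subspace_lower] subspace_0[OF subspace_lower]

lemma mul_in_lower:
  assumes "x \<in> lower n"
  shows "mul x y \<in> lower (Suc n)" "mul y x \<in> lower (Suc n)"
  using assms by (auto intro!: span_base)

lemma lower_Suc_subsetI:
  assumes "subspace S" "\<And>x y. x \<in> lower n \<Longrightarrow> mul x y \<in> S" "\<And>x y. y \<in> lower n \<Longrightarrow> mul x y \<in> S"
  shows "lower (Suc n) \<subseteq> S"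
  unfolding lower.simps using assms by (intro span_minimal) auto

lemma lower_Suc_subset: "lower (Suc n) \<subseteq> lower n"
proof (induction n)
  case (Suc n)
  show ?case
    by (rule lower_Suc_subsetI[OF subspace_lower]) (use Suc mul_in_lower in blast)+
qed simp

text \<open>The series adds one factor at a time, so it involves only some of the bracketings of n +
  1 factors; nilpotency, which concerns all of them, therefore reaches it.\<close>

lemma lower_subset_span_products: "lower n \<subseteq> span {p. is_product mul (Suc n) p}"
proof (induction n)
  case 0
  have "is_product mul (Suc 0) x" for x using is_product.single[of mul x] by simp
  then show ?case by simp
next
  case (Suc n)
  let ?S = "span {p. is_product mul (Suc (Suc n)) p}"
  have "mul x y \<in> ?S \<and> mul y x \<in> ?S" if "x \<in> lower n" for x y
  proof -
    have "x \<in> span {p. is_product mul (Suc n) p}" using that Suc by auto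
    then show ?thesis
    proof (induction rule: span_induct_alt)
      case base
      then show ?case by (simp add: mul_linear_simps span_zero)
    next
      case (step c p x)
      have p: "is_product mul (Suc n) p" using step(1) by simp
      have "is_product mul (Suc n + 1) (mul p y)" "is_product mul (1 + Suc n) (mul y p)"
        by (rule is_product.times[OF p is_product.single] is_product.times[OF is_product.single p])+
      then have "mul p y \<in> ?S" "mul y p \<in> ?S" by (auto intro: span_base)
      then show ?case using step(2) by (auto simp: mul_linear_simps intro!: span_add span_scale)
    qed
  qed
  then show ?case by (intro lower_Suc_subsetI) auto
qed

lemma lower_eventually_zero:
  assumes "nilpotent_algebra mul"
  shows "\<exists>n. lower n = {0}"
proof -
  obtain k where "k \<ge> 1" and k: "\<And>p. is_product mul k p \<Longrightarrow> p = 0"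
    using assms unfolding nilpotent_algebra_def by blast
  then have "span {p. is_product mul k p} \<subseteq> {0}"
    by (intro span_minimal) (auto simp: subspace_0)
  with \<open>k \<ge> 1\<close> have "lower (k - 1) \<subseteq> {0}"
    using lower_subset_span_products[of "k - 1"] by auto
  then show ?thesis using lower_closed(4)[of "k - 1"] by blast
qed

lemma lower_Suc_psubset:
  assumes "nilpotent_algebra mul" "lower n \<noteq> {0}"
  shows "lower (Suc n) \<subset> lower n"
proof (rule ccontr)
  assume "\<not> ?thesis"
  then have *: "lower (Suc n) = lower n" using lower_Suc_subset by blast
  have stable: "lower (n + k) = lower n" for k
  proof (induction k)
    case (Suc k)
    have "lower (n + Suc k) = lower (Suc n)" using Suc by simp
    then show ?case using * by simp
  qed simp
  obtain m where m: "lower m = {0}" using lower_eventually_zero[OF assms(1)] by blast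
  have anti: "lower (m + k) \<subseteq> lower m" for k
    by (induction k) (use lower_Suc_subset in \<open>auto simp del: lower.simps(2)\<close>)
  have "lower n \<subseteq> {0}" using stable[of m] anti[of n] m by (simp add: add.commute)
  then show False using assms(2) lower_closed(4)[of n] by blast
qed

end

section \<open>Nilpotent right alternative algebras of dimension four\<close>

locale nilpotent_right_alternative_algebra =
  complex_algebra smul mul + finite_dimensional_vector_space smul Basis
  for smul :: "complex \<Rightarrow> 'a::ab_group_add \<Rightarrow> 'a" and mul :: "'a \<Rightarrow> 'a \<Rightarrow> 'a" and Basis :: "'a set" +
  assumes right_alternative: "right_alternative mul"
    and nilpotent: "nilpotent_algebra mul"
    and dim4: "dim UNIV = 4"
begin

lemma right_alternative_linearized:
  "mul (mul x y) z + mul (mul x z) y = mul x (mul y z) + mul x (mul z y)"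
proof -
  have "mul (mul x y) z - mul x (mul y z) = - mul (mul x z) y + mul x (mul z y)"
    using right_alternative unfolding right_alternative_def by blast
  then show ?thesis by (simp add: algebra_simps)
qed

text \<open>The factor 2 is invertible. This recovers (x y) y = x (y y) and similar instances from
  the linearised identity.\<close>

lemma add_self_eq_iff: "x + x = y + y \<longleftrightarrow> x = y" for x y :: 'a
proof
  assume "x + x = y + y"
  then have "smul 2 x = smul 2 y" by (simp add: scale_left_distrib[of 1 1, simplified])
  then show "x = y" by simp
qed simp

lemma mul_mul_self: "mul (mul x y) y = mul x (mul y y)"
  using right_alternative_linearized[of x y y] by (simp only: add_self_eq_iff)

lemma dim_lower_Suc_less: "lower n \<noteq> {0} \<Longrightarrow> dim (lower (Suc n)) < dim (lower n)"
  using lower_Suc_psubset[OF nilpotent] subspace_dim_equal[OF subspace_lower subspace_lower]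
  by (metis less_imp_le not_le psubset_eq)

text \<open>Each step loses a dimension until zero is reached. Subtraction is truncated, so the
  bound is 0 from n = 4 on, that is, A^5 = 0.\<close>

lemma dim_lower_le: "dim (lower n) \<le> 4 - n"
proof (induction n)
  case 0
  then show ?case by (simp add: dim4 del: dim_UNIV)
next
  case (Suc n)
  show ?case
  proof (cases "lower n = {0}")
    case True
    then have "lower (Suc n) \<subseteq> {0}" using lower_Suc_subset by metis
    then have "dim (lower (Suc n)) = 0" by (simp only: dim_eq_0)
    then show ?thesis by linarith
  next
    case False
    then show ?thesis using dim_lower_Suc_less Suc by fastforce
  qed
qed

lemma lower_eq_zero_if_dim: "dim (lower n) = 0 \<Longrightarrow> lower n = {0}"
  using lower_closed(4)[of n] by (auto simp only: dim_eq_0)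

lemma span_insert_subspace: "subspace S \<Longrightarrow> span (insert x S) = {y. \<exists>k. y - smul k x \<in> S}"
  by (simp add: span_insert span_eq_iff[THEN iffD2])

definition square :: "'a set" where "square = lower 1"
definition cube :: "'a set" where "cube = lower 2"
definition fourth :: "'a set" where "fourth = lower 3"

lemma subspace_square: "subspace square" and subspace_cube: "subspace cube"
  and subspace_fourth: "subspace fourth"
  by (simp_all only: square_def cube_def fourth_def subspace_lower)

lemmas powers_closed =
  subspace_add[OF subspace_square] subspace_add[OF subspace_cube] subspace_add[OF subspace_fourth]
  subspace_scale[OF subspace_square] subspace_scale[OF subspace_cube] subspace_scale[OF subspace_fourth]

lemma mul_in_powers:
  "mul x y \<in> square"
  "x \<in> square \<Longrightarrow> mul x y \<in> cube" "x \<in> square \<Longrightarrow> mul y x \<in> cube"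
  "x \<in> cube \<Longrightarrow> mul x y \<in> fourth" "x \<in> cube \<Longrightarrow> mul y x \<in> fourth"
  using mul_in_lower[of _ 0] mul_in_lower[of _ 1] mul_in_lower[of _ 2]
  by (simp_all add: square_def cube_def fourth_def eval_nat_numeral del: lower.simps(2))

lemma powers_decreasing: "cube \<subseteq> square" "fourth \<subseteq> cube"
  using lower_Suc_subset[of 1] lower_Suc_subset[of 2]
  by (simp_all add: square_def cube_def fourth_def eval_nat_numeral del: lower.simps(2))

lemma mul_fourth:
  assumes "x \<in> fourth"
  shows "mul x y = 0" "mul y x = 0"
proof -
  have "lower 4 = {0}" using dim_lower_le[of 4] by (intro lower_eq_zero_if_dim) simp
  then show "mul x y = 0" "mul y x = 0" using mul_in_lower[of x 3 y] assms
    by (simp_all add: fourth_def eval_nat_numeral del: lower.simps(2))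
qed

lemma square_subsetI: "subspace S \<Longrightarrow> (\<And>x y. mul x y \<in> S) \<Longrightarrow> square \<subseteq> S"
  using lower_Suc_subsetI[of S 0] by (simp add: square_def del: lower.simps(2))

lemma cube_subsetI:
  "subspace S \<Longrightarrow> (\<And>x y. x \<in> square \<Longrightarrow> mul x y \<in> S) \<Longrightarrow> (\<And>x y. x \<in> square \<Longrightarrow> mul y x \<in> S)
   \<Longrightarrow> cube \<subseteq> S"
  using lower_Suc_subsetI[of S 1] by (simp add: square_def cube_def eval_nat_numeral del: lower.simps(2))

lemma fourth_subsetI:
  "subspace S \<Longrightarrow> (\<And>x y. x \<in> cube \<Longrightarrow> mul x y \<in> S) \<Longrightarrow> (\<And>x y. x \<in> cube \<Longrightarrow> mul y x \<in> S)
   \<Longrightarrow> fourth \<subseteq> S"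
  using lower_Suc_subsetI[of S 2] by (simp add: cube_def fourth_def eval_nat_numeral del: lower.simps(2))

section \<open>Adapted bases\<close>

definition lin_comb :: "'a \<Rightarrow> 'a \<Rightarrow> 'a \<Rightarrow> 'a \<Rightarrow> complex ^ 4 \<Rightarrow> 'a" where
  "lin_comb a b c d x = smul (x$1) a + smul (x$2) b + smul (x$3) c + smul (x$4) d"

lemma linear_lin_comb: "Vector_Spaces.linear (*s) smul (lin_comb a b c d)"
  by (intro linearI vec.vector_space_axioms vector_space_axioms)
    (simp_all add: lin_comb_def scale_left_distrib scale_right_distrib)

text \<open>Spanning gives surjectivity, and equality of dimensions turns it into
  injectivity.\<close>

lemma bij_lin_comb:
  assumes "span {a, b, c, d} = UNIV"
  shows "bij (lin_comb a b c d)"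
proof -
  interpret pair: finite_dimensional_vector_space_pair
    "(*s) :: complex \<Rightarrow> complex ^ 4 \<Rightarrow> complex ^ 4" cart_basis smul Basis ..
  have "\<exists>v. x = lin_comb a b c d v" for x
  proof -
    have "x \<in> span {a, b, c, d}" using assms by simp
    then obtain k1 k2 k3 k4 where "x - smul k1 a - smul k2 b - smul k3 c - smul k4 d = 0"
      by (auto simp: span_breakdown_eq)
    then have "x = lin_comb a b c d (vec4 k1 k2 k3 k4)"
      by (simp add: lin_comb_def algebra_simps)
    then show ?thesis by blast
  qed
  then have "surj (lin_comb a b c d)" by (auto simp: surj_def)
  moreover from this have "inj (lin_comb a b c d)"
    by (rule pair.linear_surjective_imp_injective[OF linear_lin_comb])
      (simp add: dim4 vec.dim_UNIV card_cart_basis del: dim_UNIV)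
  ultimately show ?thesis by (simp add: bij_def)
qed

lemma isomorphic_lin_comb:
  assumes "span {a, b, c, d} = UNIV"
    and "\<And>x y. lin_comb a b c d (m x y) = mul (lin_comb a b c d x) (lin_comb a b c d y)"
  shows "algebra_isomorphic smul mul (*s) m"
  by (rule algebra_isomorphicI[OF linear_lin_comb bij_lin_comb]) fact+


section \<open>The case of a square of dimension three\<close>

lemma isomorphic_R4_9:
  assumes dim: "dim square = 3"
  shows "algebra_isomorphic smul mul (*s) R4_9"
proof -
  have "square \<noteq> UNIV" using dim dim4 by auto
  then obtain e1 where e1: "e1 \<notin> square" by blast
  \<comment> \<open>The right-normed powers of e1 will form the basis; right alternativity
    determines all other products among them.\<close>
  define e2 where "e2 = mul e1 e1"
  define e3 where "e3 = mul e1 e2"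
  define e4 where "e4 = mul e1 e3"
  have mem: "e2 \<in> square" "e3 \<in> cube" "e4 \<in> fourth"
    by (auto simp: e2_def e3_def e4_def intro!: mul_in_powers)
  have e21: "mul e2 e1 = e3"
    using mul_mul_self[of e1 e1] by (simp add: e2_def e3_def)
  have e31: "mul e3 e1 = mul e2 e2"
    using mul_mul_self[of e2 e1] by (simp add: e21 e2_def[symmetric])
  \<comment> \<open>In (e1 e1) e2 + (e1 e2) e1 = e1 (e1 e2) + e1 (e2 e1) the left side is twice e2
    e2, because e3 e1 = e2 e2, and the right side is twice e4.\<close>
  have "mul e2 e2 + mul e2 e2 = e4 + e4"
    using right_alternative_linearized[of e1 e1 e2] by (simp add: e21 e31 flip: e2_def e3_def e4_def)
  then have e22: "mul e2 e2 = e4" by (simp only: add_self_eq_iff)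
  note e4 = mul_fourth[OF mem(3)]
  have e23: "mul e2 e3 = 0"
    using right_alternative_linearized[of e1 e1 e3]
    by (simp add: e31 e22 e4 flip: e2_def e3_def e4_def)
  have e32: "mul e3 e2 = 0"
    using mul_mul_self[of e3 e1] by (simp add: e31 e22 e4 flip: e2_def)
  have "0 + 0 = mul e3 e3 + mul e3 e3"
    using right_alternative_linearized[of e3 e1 e2]
    by (simp add: e31 e22 e21 e32 e4 mul_linear_simps flip: e3_def)
  then have e33: "mul e3 e3 = 0" by (simp only: add_self_eq_iff)
  note table = e2_def[symmetric] e3_def[symmetric] e4_def[symmetric] e21 e22 e23 e31 e32 e33 e4
    mul_linear_simps
  \<comment> \<open>\<open>dec1\<close> to \<open>dec4\<close> show that e_n spans A^n modulo
    A^{n+1}. The first is a dimension count; the others expand products whose factors have already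
    been decomposed.\<close>
  have dec1: "\<exists>k. x - smul k e1 \<in> square" for x
  proof -
    have "dim (insert e1 square) = 4"
      using e1 dim by (simp add: dim_insert span_eq_iff[THEN iffD2, OF subspace_square])
    then have "span (insert e1 square) = UNIV"
      using dim4 by (simp only: dim_eq_full[symmetric] dimension_def dim_UNIV)
    then show ?thesis by (auto simp: span_insert_subspace[OF subspace_square])
  qed
  have "square \<subseteq> span (insert e2 cube)"
  proof (rule square_subsetI[OF subspace_span])
    fix x y
    obtain k m where "x - smul k e1 \<in> square" "y - smul m e1 \<in> square" using dec1 by blast
    moreover define q r where "q = x - smul k e1" and "r = y - smul m e1"
    ultimately have qr: "q \<in> square" "r \<in> square" and "x = smul k e1 + q" "y = smul m e1 + r"
      by simp_all
    then have "mul x y - smul (k * m) e2 = smul k (mul e1 r) + mul q y"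
      by (simp add: table scale_right_distrib)
    also have "\<dots> \<in> cube" using qr by (intro powers_closed mul_in_powers)
    finally show "mul x y \<in> span (insert e2 cube)"
      by (auto simp: span_insert_subspace[OF subspace_cube])
  qed
  then have dec2: "\<exists>k. x - smul k e2 \<in> cube" if "x \<in> square" for x
    using that by (auto simp: span_insert_subspace[OF subspace_cube])
  have "cube \<subseteq> span (insert e3 fourth)"
  proof (rule cube_subsetI[OF subspace_span])
    fix x y assume "x \<in> square"
    obtain m where m: "y - smul m e1 \<in> square" using dec1 by blast
    obtain k n where "x - smul k e2 \<in> cube" "y - smul m e1 - smul n e2 \<in> cube"
      using dec2 \<open>x \<in> square\<close> m by blast
    moreover define q r where "q = x - smul k e2" and "r = y - smul m e1 - smul n e2"
    ultimately have qr: "q \<in> cube" "r \<in> cube"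
      and xy: "x = smul k e2 + q" "y = smul m e1 + smul n e2 + r"
      by simp_all
    have "mul x y - smul (k * m) e3 = smul (k * n) e4 + smul k (mul e2 r) + mul q y"
      unfolding xy by (simp add: table scale_right_distrib mult.commute)
    also have "\<dots> \<in> fourth" using qr mem by (intro powers_closed mul_in_powers)
    finally show "mul x y \<in> span (insert e3 fourth)"
      by (auto simp: span_insert_subspace[OF subspace_fourth])
    have "mul y x - smul (m * k) e3 = smul (n * k) e4 + smul k (mul r e2) + mul y q"
      unfolding xy by (simp add: table scale_right_distrib mult.commute)
    also have "\<dots> \<in> fourth" using qr mem by (intro powers_closed mul_in_powers)
    finally show "mul y x \<in> span (insert e3 fourth)"
      by (auto simp: span_insert_subspace[OF subspace_fourth])
  qed
  then have dec3: "\<exists>k. x - smul k e3 \<in> fourth" if "x \<in> cube" for x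
    using that by (auto simp: span_insert_subspace[OF subspace_fourth])
  have "fourth \<subseteq> span {e4}"
  proof (rule fourth_subsetI[OF subspace_span])
    fix x y assume "x \<in> cube"
    obtain m where m: "y - smul m e1 \<in> square" using dec1 by blast
    obtain n where n: "y - smul m e1 - smul n e2 \<in> cube" using dec2 m by blast
    obtain k l where "x - smul k e3 \<in> fourth" "y - smul m e1 - smul n e2 - smul l e3 \<in> fourth"
      using dec3 \<open>x \<in> cube\<close> n by blast
    moreover define q r where "q = x - smul k e3" and "r = y - smul m e1 - smul n e2 - smul l e3"
    ultimately have qr: "q \<in> fourth" "r \<in> fourth"
      and xy: "x = smul k e3 + q" "y = smul m e1 + smul n e2 + smul l e3 + r"
      by simp_all
    \<comment> \<open>The remainders \<open>q\<close> and \<open>r\<close> lie in A^4, which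
      annihilates the algebra.\<close>
    have "mul x y = smul (k * m) e4" "mul y x = smul (m * k) e4"
      unfolding xy by (simp_all add: table mul_fourth[OF qr(1)] mul_fourth[OF qr(2)])
    then show "mul x y \<in> span {e4}" "mul y x \<in> span {e4}"
      by (simp_all add: span_scale span_base)
  qed
  then have dec4: "\<exists>k. x - smul k e4 = 0" if "x \<in> fourth" for x
    using that by (auto simp: span_singleton)
  have "x \<in> span {e1, e2, e3, e4}" for x
    unfolding span_breakdown_eq span_empty using dec1 dec2 dec3 dec4 by fast
  then show ?thesis
    by (intro isomorphic_lin_comb[of e1 e2 e3 e4])
      (auto simp: lin_comb_def R4_nth table scale_right_distrib scale_left_distrib mult.commute)
qed

section \<open>The case of a square of dimension two\<close>

text \<open>The series by itself only places A^2 A^2 in A^3. Right alternativity expresses (x y) c'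
  through (x c') y, x (y c') and x (c' y), which all lie in A^4 = 0.\<close>

lemma mul_square_square:
  assumes "fourth = {0}" "c \<in> square" "c' \<in> square"
  shows "mul c c' = 0"
proof -
  have fourth: "z = 0" if "z \<in> fourth" for z using that assms(1) by simp
  have *: "mul (mul x y) c' = 0" for x y
  proof -
    have "mul (mul x c') y = 0" "mul x (mul y c') = 0" "mul x (mul c' y) = 0"
      by (intro fourth mul_in_powers assms)+
    then show ?thesis using right_alternative_linearized[of x y c'] by simp
  qed
  have "subspace {z. mul z c' = 0}"
    by (auto simp: subspace_def mul_linear_simps)
  then have "square \<subseteq> {z. mul z c' = 0}" by (rule square_subsetI) (simp add: *)
  then show ?thesis using assms(2) by blast
qed

text \<open>This is \<beta> \<noteq> 0. If A A^2 = 0, then (x y) y = 0 throughout, and this squeezes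
  A^2 into A^3.\<close>

lemma exists_left_mul_square_nonzero:
  assumes dims: "dim square = 2" "dim cube = 1" and four: "fourth = {0}"
  shows "\<exists>a. \<exists>c\<in>square. mul a c \<noteq> 0"
proof (rule ccontr)
  assume "\<not> ?thesis"
  then have left0: "mul x c = 0" if "c \<in> square" for x c using that by blast
  then have xyy: "mul (mul x y) y = 0" for x y
    by (simp add: mul_mul_self mul_in_powers)
  have cube0: "mul z y = 0" if "z \<in> cube" for z y
    using mul_in_powers(4)[OF that] four by auto
  have "\<exists>c\<in>square. \<exists>a. mul c a \<noteq> 0"
  proof (rule ccontr)
    assume "\<not> ?thesis"
    then have "cube \<subseteq> {0}"
      by (intro cube_subsetI) (auto simp: left0 subspace_0)
    then have "dim cube = 0" by (simp only: dim_eq_0)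
    then show False using dims by simp
  qed
  then obtain c a where ca: "c \<in> square" "mul c a \<noteq> 0" by blast
  have dec: "\<exists>k. z - smul k c \<in> cube" if "z \<in> square" for z
  proof -
    have "c \<notin> cube" using cube0 ca by blast
    then have "dim (insert c cube) = 2"
      using dims by (simp add: dim_insert span_eq_iff[THEN iffD2, OF subspace_cube])
    then have "span (insert c cube) = span square"
      using dims ca powers_decreasing by (intro dim_eq_span) auto
    then show ?thesis
      using that span_base[of z square] by (auto simp: span_insert_subspace[OF subspace_cube])
  qed
  \<comment> \<open>A^2 is spanned by c and A^3, while A^3 a = 0 and c a \<noteq> 0; so right
    multiplication by a detects A^3 inside A^2.\<close>
  have in_cube: "z \<in> cube" if z: "z \<in> square" "mul z a = 0" for z
  proof -
    obtain k where k: "z - smul k c \<in> cube" using dec z by blast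
    then have "smul k (mul c a) = 0" using cube0[OF k, of a] z by (simp add: mul_linear_simps)
    then show ?thesis using k ca by simp
  qed
  have "mul x y \<in> cube" for x y
  proof (rule in_cube[OF mul_in_powers(1)])
    \<comment> \<open>From (x a) a = 0 it follows that x a lies in A^3, hence (x a) y = 0, and
      linearisation gives (x y) a = 0.\<close>
    have "mul x a \<in> cube" by (rule in_cube[OF mul_in_powers(1)]) (rule xyy)
    then have "mul (mul x a) y = 0" by (rule cube0)
    then show "mul (mul x y) a = 0"
      using right_alternative_linearized[of x y a] by (simp add: left0 mul_in_powers)
  qed
  then have "square \<subseteq> cube" by (rule square_subsetI[OF subspace_cube])
  then show False using dim_subset[of square cube] dims by simp
qed

lemma adapted_basis:
  assumes dims: "dim square = 2" "dim cube = 1" and four: "fourth = {0}"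
  obtains a b c d where "span {a, b, c, d} = UNIV" "square = span {c, d}" "cube = span {d}"
    "mul a c = d" "mul b c = 0"
proof -
  obtain a c where c: "c \<in> square" and nz: "mul a c \<noteq> 0"
    using exists_left_mul_square_nonzero[OF assms] by blast
  define d where "d = mul a c"
  have d: "d \<in> cube" "d \<noteq> 0" using c nz by (auto simp: d_def intro: mul_in_powers)
  have cube0: "mul y z = 0" if "z \<in> cube" for z y
    using mul_in_powers(5)[OF that] four by auto
  have cube: "cube = span {d}"
    using subspace_dim_equal[of "span {d}" cube] d dims subspace_cube
    by (auto simp: span_minimal)
  \<comment> \<open>A A^3 = 0 and a c \<noteq> 0 keep c outside A^3; below, A^2 A^2 = 0 keeps a
    outside A^2 in the same way.\<close>
  have "c \<notin> span {d}" using nz cube0 cube by metis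
  then have dim_cd: "dim {c, d} = 2" using d by (simp add: dim_insert)
  moreover have "span {c, d} \<subseteq> square"
    using c d powers_decreasing by (intro span_minimal subspace_square) auto
  ultimately have square: "square = span {c, d}"
    using subspace_dim_equal[of "span {c, d}" square] dims subspace_square by auto
  have "a \<notin> span {c, d}"
    using nz mul_square_square[OF four _ c] square by blast
  then have dim_acd: "dim {a, c, d} = 3" using dim_cd by (subst dim_insert) simp
  then have "dim (span {a, c, d}) = 3" by simp
  then have "span {a, c, d} \<noteq> UNIV" using dim4 by (auto simp del: dim_UNIV dim_span)
  then obtain b0 where b0: "b0 \<notin> span {a, c, d}" by blast
  obtain k where k: "mul b0 c = smul k d"
    using mul_in_powers(3)[OF c, of b0] cube by (auto simp: span_singleton)
  \<comment> \<open>Subtracting k a moves b0 into the kernel of \<beta>.\<close>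
  define b where "b = b0 - smul k a"
  have "b \<notin> span {a, c, d}"
  proof
    assume "b \<in> span {a, c, d}"
    then have "b + smul k a \<in> span {a, c, d}" by (intro span_add span_scale) (auto intro: span_base)
    then show False using b0 by (simp add: b_def)
  qed
  then have "dim {b, a, c, d} = 4" using dim_acd by (subst dim_insert) simp
  then have "span {b, a, c, d} = UNIV"
    using dim4 by (simp only: dim_eq_full[symmetric] dimension_def dim_UNIV)
  moreover have "mul b c = 0" using k by (simp add: b_def d_def mul_linear_simps)
  ultimately show ?thesis
    using square cube d_def[symmetric] by (intro that[of a b c d]) (simp_all only: insert_commute[of a])
qed

lemma isomorphic_graded_mul:
  assumes dims: "dim square = 2" "dim cube = 1" and four: "fourth = {0}"
  obtains P Q \<alpha> where "algebra_isomorphic smul mul (*s) (graded_mul P Q \<alpha>)"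
    "right_alternative (graded_mul P Q \<alpha>)" "P \<noteq> 0"
proof -
  obtain a b c d where basis: "span {a, b, c, d} = UNIV" and square: "square = span {c, d}"
    and cube: "cube = span {d}" and ac: "mul a c = d" and bc: "mul b c = 0"
    using adapted_basis[OF assms] by metis
  have "\<exists>p q. mul x y = smul p c + smul q d" for x y
  proof -
    have "mul x y \<in> span {c, d}" using mul_in_powers(1) square by simp
    then obtain p q where "mul x y - smul p c - smul q d = 0" by (auto simp: span_breakdown_eq)
    then have "mul x y = smul p c + smul q d" by (simp add: algebra_simps)
    then show ?thesis by blast
  qed
  then obtain p q where pq: "mul x y = smul (p x y) c + smul (q x y) d" for x y by metis
  have c: "c \<in> square" and d: "d \<in> cube" using square cube by (auto intro: span_base)
  have "\<exists>k. mul c x = smul k d" for x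
    using mul_in_powers(2)[OF c] cube by (auto simp: span_singleton)
  then obtain s where s: "mul c x = smul (s x) d" for x by metis
  have d0: "mul d x = 0" "mul x d = 0" for x
    using mul_in_powers(4,5)[OF d] four by auto
  have cc: "mul c c = 0" using mul_square_square[OF four c c] .
  define bas where "bas i = (if i = 1 then a else b)" for i :: 2
  define P Q \<alpha> where "P = (\<chi> i j. p (bas i) (bas j))" and "Q = (\<chi> i j. q (bas i) (bas j))"
    and "\<alpha> = (\<chi> i. s (bas i))"
  have PQ: "mul a a = smul (P$1$1) c + smul (Q$1$1) d" "mul a b = smul (P$1$2) c + smul (Q$1$2) d"
    "mul b a = smul (P$2$1) c + smul (Q$2$1) d" "mul b b = smul (P$2$2) c + smul (Q$2$2) d"
    "mul c a = smul (\<alpha>$1) d" "mul c b = smul (\<alpha>$2) d"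
    using pq s by (auto simp: P_def Q_def \<alpha>_def bas_def)
  let ?L = "lin_comb a b c d"
  have hom: "?L (graded_mul P Q \<alpha> x y) = mul (?L x) (?L y)" for x y
    by (simp add: lin_comb_def graded_mul_def mul_linear_simps PQ ac bc cc d0
        scale_right_distrib scale_left_distrib algebra_simps)
  have bij: "bij ?L" by (rule bij_lin_comb[OF basis])
  interpret L: Vector_Spaces.linear "(*s)" smul ?L by (rule linear_lin_comb)
  have ra: "right_alternative (graded_mul P Q \<alpha>)"
    unfolding right_alternative_def
  proof (intro allI)
    fix x y z
    let ?m = "graded_mul P Q \<alpha>"
    have "?L (?m (?m x y) z - ?m x (?m y z)) = ?L (- ?m (?m x z) y + ?m x (?m z y))"
      using right_alternative unfolding L.add L.diff L.neg hom right_alternative_def by blast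
    then show "?m (?m x y) z - ?m x (?m y z) = - ?m (?m x z) y + ?m x (?m z y)"
      using bij_is_inj[OF bij] by (simp only: inj_eq)
  qed
  \<comment> \<open>If \<phi> vanished, every product would lie in A^3, against dim A^3 < dim
    A^2.\<close>
  have "P \<noteq> 0"
  proof
    assume "P = 0"
    then have *: "mul (?L x) (?L y) \<in> cube" for x y
      unfolding hom[symmetric] cube
      by (simp add: graded_mul_def lin_comb_def span_scale span_base)
    have "mul x y \<in> cube" for x y
      using *[of "inv ?L x" "inv ?L y"] by (simp add: bij_is_surj[OF bij] surj_f_inv_f)
    then have "square \<subseteq> cube" by (rule square_subsetI[OF subspace_cube])
    then show False using dim_subset[of square cube] dims by simp
  qed
  then show ?thesis
    using that[OF isomorphic_lin_comb[OF basis hom] ra] by blast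
qed

section \<open>The classification of pure algebras\<close>

lemma cube_zero_imp_non_pure:
  assumes "cube = {0}"
  shows "non_pure_algebra mul"
  unfolding non_pure_algebra_def
  using mul_in_powers(2,3)[OF mul_in_powers(1)] assms by blast

theorem pure_classification:
  assumes "pure_algebra mul"
  shows "\<exists>R \<in> {R4_1, R4_2, R4_3, R4_4, R4_5, R4_6, R4_7, R4_8, R4_9}.
           algebra_isomorphic smul mul (*s) R"
proof -
  have cube: "cube \<noteq> {0}" using assms cube_zero_imp_non_pure by (auto simp: pure_algebra_def)
  then have square: "square \<noteq> {0}" using powers_decreasing lower_closed(4)[of 2] by (auto simp: cube_def)
  have "dim square \<le> 3" using dim_lower_le[of 1] by (simp add: square_def)
  moreover have "dim cube < dim square"
    using dim_lower_Suc_less[of 1] square by (simp add: square_def cube_def eval_nat_numeral)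
  moreover have "dim fourth < dim cube"
    using dim_lower_Suc_less[of 2] cube by (simp add: cube_def fourth_def eval_nat_numeral)
  \<comment> \<open>If dim A^2 is below 3, the strict descent dim A^2 > dim A^3 > dim A^4 leaves
    only 2, 1, 0.\<close>
  ultimately consider "dim square = 3" | "dim square = 2" "dim cube = 1" "dim fourth = 0" by linarith
  then show ?thesis
  proof cases
    case 1
    then show ?thesis using isomorphic_R4_9 by blast
  next
    case 2
    then have "fourth = {0}" unfolding fourth_def by (intro lower_eq_zero_if_dim)
    then obtain P Q \<alpha> where iso: "algebra_isomorphic smul mul (*s) (graded_mul P Q \<alpha>)"
      and ra: "right_alternative (graded_mul P Q \<alpha>)" and "P \<noteq> 0"
      using isomorphic_graded_mul 2 by metis
    from graded_mul_classification[OF ra \<open>P \<noteq> 0\<close>] show ?thesis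
      using algebra_isomorphic_trans[OF iso] by blast
  qed
qed

end

theorem theoremA:
  fixes smul :: "complex \<Rightarrow> 'a::ab_group_add \<Rightarrow> 'a"
    and mul :: "'a \<Rightarrow> 'a \<Rightarrow> 'a"
  assumes "complex_algebra smul mul"
    and "(UNIV :: 'a set) \<noteq> {0}"
    and "vector_space.dim smul (UNIV :: 'a set) = 4"
    and "right_alternative mul"
    and "nilpotent_algebra mul"
    and "pure_algebra mul"
  shows "\<exists>R \<in> {R4_1, R4_2, R4_3, R4_4, R4_5, R4_6, R4_7, R4_8, R4_9}.
           algebra_isomorphic smul mul (*s) R"
proof -
  interpret complex_algebra smul mul by fact
  obtain B where B: "independent B" "UNIV \<subseteq> span B" "card B = dim UNIV"
    by (rule basis_exists[of UNIV])
  \<comment> \<open>Infinite sets have cardinality 0 by convention, so cardinality 4 forces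
    finiteness.\<close>
  have finite: "finite B" using B(3) assms(3) by (intro card_ge_0_finite) linarith
  interpret nilpotent_right_alternative_algebra smul mul B
  proof unfold_locales
    show "span B = UNIV" using B(2) by blast
  qed (rule finite B assms)+
  show ?thesis by (rule pure_classification) fact
qed

end
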